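(* Let $\alpha\in[0,1]$ and consider the hyperbolic relaxation system $$\partial_t u+\partial_x v=0,\qquad \partial_t v+\frac{1}{\varepsilon^{2\alpha}}\partial_x p(u)=-\frac{1}{\varepsilon^{1+\alpha}}\bigl(v-f(u)\bigr),$$ with $p'(u)>0$. Let an $s$-stage IMEX-RK method $(\tilde A,\tilde b;A,b)$ of type I or type II be applied to it in time, with time step $\Delta t>0$, in the form $$U=u^n e-\Delta t\,A\,V_x,\qquad V=v^n e+\frac{\Delta t}{\varepsilon^{1+\alpha}}\tilde A f(U)-\frac{\Delta t}{\varepsilon^{1+\alpha}}A\bigl(V+\varepsilon^{1-\alpha}p(U)_x\bigr),$$ $$u^{n+1}=u^n-\Delta t\,b^T V_x,\qquad v^{n+1}=v^n+\frac{\Delta t}{\varepsilon^{1+\alpha}}\tilde b^T f(U)-\frac{\Delta t}{\varepsilon^{1+\alpha}}b^T\bigl(V+\varepsilon^{1-\alpha}p(U)_x\bigr).$$ Suppose the IMEX-RK method is globally stiffly accurate (GSA). (i) If $\alpha=1$, then as $\varepsilon\to0$ the scheme becomes the IMEX-RK method characterized by the pairs $(\tilde A,\tilde b)$ and $(A,b)$ for the limit convection-diffusion equation $\partial_t u+\partial_x f(u)=\partial_{xx}p(u)$, with the convection term treated explicitly and the diffusion term treated implicitly, that is $$\frac{U-u^n e}{\Delta t}+\tilde A f(U)_x=A\,p(U)_{xx},\qquad \frac{u^{n+1}-u^n}{\Delta t}+\tilde b^T f(U)_x=b^T p(U)_{xx}.$$ (ii) If $\alpha\in[0,1)$, then as $\varepsilon\to0$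 the scheme yields the explicit Runge-Kutta method characterized by the pair $(\tilde A,\tilde b)$ for the limit scalar conservation law $\partial_t u+\partial_x f(u)=0$, that is $$\frac{U-u^n e}{\Delta t}+\tilde A f(U)_x=0,\qquad \frac{u^{n+1}-u^n}{\Delta t}+\tilde b^T f(U)_x=0.$$
   Context: The schemes are discrete in time and continuous in the space variable $x$; subscripts $x$, $xx$ denote space derivatives. $u^n,v^n$ are the (scalar, smooth in $x$) approximations of $u,v$ at time level $n$. $U=(U^1,\dots,U^s)^T$ and $V=(V^1,\dots,V^s)^T$ are the vectors of internal stages (each component a function of $x$), $f(U)$ and $p(U)$ are the vectors with components $f(U^i)$ and $p(U^i)$, and $e=(1,\dots,1)^T\in\mathbb R^s$. An $s$-stage IMEX-RK method is given by two Butcher tableaux: an explicit one $(\tilde A,\tilde b)$, with $\tilde A=(\tilde a_{ij})\in\mathbb R^{s\times s}$ strictly lower triangular and $\tilde b=(\tilde b_i)\in\mathbb R^s$, and a diagonally implicit one $(A,b)$, with $A=(a_{ij})\in\mathbb R^{s\times s}$ lower triangular and $b=(b_i)\in\mathbb R^s$. It is of type I if $A$ is invertible (all $a_{ii}\ne0$); it is of type II if $A=\begin{pmatrix}0&0\\ a&\hat A\end{pmatrix}$ with $a\in\mathbb R^{s-1}$ and $\hat A\in\mathbb R^{(s-1)\times(s-1)}$ invertible ($a_{ii}\neq 0$ for $i=2,\dots,s$). The method is globally stiffly accurate (GSA) if $a_{si}=b_i$ for $i=1,\dots,s$ and $\tilde a_{si}=\tilde b_i$ for $i=1,\dots,s-1$,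 with $\tilde b_s=0$; equivalently $b^T=e_s^TA$ and $\tilde b^T=e_s^T\tilde A$, where $e_s=(0,\dots,0,1)^T$. The limit $\varepsilon\to0$ is formal (leading order in $\varepsilon$), taken with $\Delta t>0$, the functions $f,p$ and the data $u^n,v^n$ fixed independently of $\varepsilon$; the assertion concerns the relations determining $U$ and $u^{n+1}$. *)

theory Defs
  imports
    "HOL-Analysis.Derivative"
    "HOL-Library.Landau_Symbols"
    "Jordan_Normal_Form.Matrix"
begin

unbundle no inner_syntax

text \<open>Stages are numbered \<open>0, \<dots>, s - 1\<close>.\<close>

definition imex_tableaux ::
  "nat \<Rightarrow> real mat \<Rightarrow> real vec \<Rightarrow> real mat \<Rightarrow> real vec \<Rightarrow> bool" where
  "imex_tableaux s At bt A b \<longleftrightarrow>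
     0 < s \<and>
     At \<in> carrier_mat s s \<and> bt \<in> carrier_vec s \<and>
     A \<in> carrier_mat s s \<and> b \<in> carrier_vec s \<and>
     (\<forall>i<s. \<forall>j<s. i \<le> j \<longrightarrow> At $$ (i, j) = 0) \<and>
     (\<forall>i<s. \<forall>j<s. i < j \<longrightarrow> A $$ (i, j) = 0)"

definition type_I :: "real mat \<Rightarrow> bool" where
  "type_I A \<longleftrightarrow> invertible_mat A"

definition type_II :: "nat \<Rightarrow> real mat \<Rightarrow> bool" where
  "type_II s A \<longleftrightarrow>
     (\<exists>a Ah. a \<in> carrier_mat (s - 1) 1 \<and> Ah \<in> carrier_mat (s - 1) (s - 1) \<and>
        invertible_mat Ah \<and>
        A = four_block_mat (0\<^sub>m 1 1) (0\<^sub>m 1 (s - 1)) a Ah)"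

definition globally_stiffly_accurate ::
  "nat \<Rightarrow> real mat \<Rightarrow> real vec \<Rightarrow> real mat \<Rightarrow> real vec \<Rightarrow> bool" where
  "globally_stiffly_accurate s At bt A b \<longleftrightarrow>
     (\<forall>i<s. A $$ (s - 1, i) = b $ i) \<and>
     (\<forall>i<s - 1. At $$ (s - 1, i) = bt $ i) \<and> bt $ (s - 1) = 0"

definition C_k :: "nat \<Rightarrow> (real \<Rightarrow> real) \<Rightarrow> bool" where
  "C_k k g \<longleftrightarrow>
     (\<forall>j<k. \<forall>x. (deriv ^^ j) g differentiable (at x)) \<and>
     continuous_on UNIV ((deriv ^^ k) g)"

text \<open>
  A stage vector is a family \<open>W\<close> of functions of the space variable, of which only
  \<open>W 0, \<dots>, W (s - 1)\<close> matter; \<open>at_point s W x\<close> is its value at \<open>x\<close>.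
  The suffixes \<open>_x\<close> and \<open>_xx\<close> are space derivatives of the composed functions.
\<close>

type_synonym stages = "nat \<Rightarrow> real \<Rightarrow> real"

definition at_point :: "nat \<Rightarrow> stages \<Rightarrow> real \<Rightarrow> real vec" where
  "at_point s W x = vec s (\<lambda>i. W i x)"

definition ones :: "nat \<Rightarrow> real vec" where
  "ones s = vec s (\<lambda>_. 1)"

definition app :: "(real \<Rightarrow> real) \<Rightarrow> stages \<Rightarrow> stages" where
  "app g W = (\<lambda>i x. g (W i x))"

definition D_x :: "stages \<Rightarrow> stages" where
  "D_x W = (\<lambda>i. deriv (W i))"

definition D_xx :: "stages \<Rightarrow> stages" where
  "D_xx W = (\<lambda>i. deriv (deriv (W i)))"

text \<open>The two equations for the \<open>u\<close>-component, which do not involve \<open>\<epsilon>\<close>.\<close>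

definition u_equations ::
  "nat \<Rightarrow> real mat \<Rightarrow> real vec \<Rightarrow> real \<Rightarrow> (real \<Rightarrow> real) \<Rightarrow>
   stages \<Rightarrow> stages \<Rightarrow> (real \<Rightarrow> real) \<Rightarrow> bool" where
  "u_equations s A b dt un U V un1 \<longleftrightarrow>
     (\<forall>x. at_point s U x = un x \<cdot>\<^sub>v ones s - dt \<cdot>\<^sub>v (A *\<^sub>v at_point s (D_x V) x) \<and>
          un1 x = un x - dt * (b \<bullet> at_point s (D_x V) x))"

text \<open>Right-hand sides of the two equations for the \<open>v\<close>-component.\<close>

definition v_stage_rhs ::
  "nat \<Rightarrow> real mat \<Rightarrow> real mat \<Rightarrow> (real \<Rightarrow> real) \<Rightarrow> (real \<Rightarrow> real) \<Rightarrow>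
   real \<Rightarrow> real \<Rightarrow> real \<Rightarrow> (real \<Rightarrow> real) \<Rightarrow> stages \<Rightarrow> stages \<Rightarrow> real \<Rightarrow> real vec" where
  "v_stage_rhs s At A f p \<alpha> \<epsilon> dt vn U V x =
     vn x \<cdot>\<^sub>v ones s
     + (dt / \<epsilon> powr (1 + \<alpha>)) \<cdot>\<^sub>v (At *\<^sub>v at_point s (app f U) x)
     - (dt / \<epsilon> powr (1 + \<alpha>)) \<cdot>\<^sub>v
         (A *\<^sub>v (at_point s V x + \<epsilon> powr (1 - \<alpha>) \<cdot>\<^sub>v at_point s (D_x (app p U)) x))"

definition v_step_rhs ::
  "nat \<Rightarrow> real vec \<Rightarrow> real vec \<Rightarrow> (real \<Rightarrow> real) \<Rightarrow> (real \<Rightarrow> real) \<Rightarrow>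
   real \<Rightarrow> real \<Rightarrow> real \<Rightarrow> (real \<Rightarrow> real) \<Rightarrow> stages \<Rightarrow> stages \<Rightarrow> real \<Rightarrow> real" where
  "v_step_rhs s bt b f p \<alpha> \<epsilon> dt vn U V x =
     vn x
     + (dt / \<epsilon> powr (1 + \<alpha>)) * (bt \<bullet> at_point s (app f U) x)
     - (dt / \<epsilon> powr (1 + \<alpha>)) *
         (b \<bullet> (at_point s V x + \<epsilon> powr (1 - \<alpha>) \<cdot>\<^sub>v at_point s (D_x (app p U)) x))"

definition relaxation_scheme ::
  "nat \<Rightarrow> real mat \<Rightarrow> real vec \<Rightarrow> real mat \<Rightarrow> real vec \<Rightarrow>
   (real \<Rightarrow> real) \<Rightarrow> (real \<Rightarrow> real) \<Rightarrow> real \<Rightarrow> real \<Rightarrow> real \<Rightarrow> (real \<Rightarrow> real) \<Rightarrow> (real \<Rightarrow> real) \<Rightarrow>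
   stages \<Rightarrow> stages \<Rightarrow> (real \<Rightarrow> real) \<Rightarrow> (real \<Rightarrow> real) \<Rightarrow> bool" where
  "relaxation_scheme s At bt A b f p \<alpha> \<epsilon> dt un vn U V un1 vn1 \<longleftrightarrow>
     u_equations s A b dt un U V un1 \<and>
     (\<forall>x. at_point s V x = v_stage_rhs s At A f p \<alpha> \<epsilon> dt vn U V x \<and>
          vn1 x = v_step_rhs s bt b f p \<alpha> \<epsilon> dt vn U V x)"

text \<open>
  The \<open>\<epsilon>\<close>-independent functions \<open>U, V, un1, vn1\<close> satisfy the scheme to leading order:
  the \<open>u\<close>-equations hold, and in the \<open>v\<close>-equations, whose leading terms
  are of order \<open>\<epsilon>\<close> to the power \<open>-(1 + \<alpha>)\<close>, everything of that order cancels.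
\<close>

definition leading_order_scheme ::
  "nat \<Rightarrow> real mat \<Rightarrow> real vec \<Rightarrow> real mat \<Rightarrow> real vec \<Rightarrow>
   (real \<Rightarrow> real) \<Rightarrow> (real \<Rightarrow> real) \<Rightarrow> real \<Rightarrow> real \<Rightarrow> (real \<Rightarrow> real) \<Rightarrow> (real \<Rightarrow> real) \<Rightarrow>
   stages \<Rightarrow> stages \<Rightarrow> (real \<Rightarrow> real) \<Rightarrow> (real \<Rightarrow> real) \<Rightarrow> bool" where
  "leading_order_scheme s At bt A b f p \<alpha> dt un vn U V un1 vn1 \<longleftrightarrow>
     u_equations s A b dt un U V un1 \<and>
     (\<forall>x. (\<forall>i<s. (\<lambda>\<epsilon>. V i x - v_stage_rhs s At A f p \<alpha> \<epsilon> dt vn U V x $ i)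
                    \<in> o[at_right 0](\<lambda>\<epsilon>. \<epsilon> powr - (1 + \<alpha>))) \<and>
          (\<lambda>\<epsilon>. vn1 x - v_step_rhs s bt b f p \<alpha> \<epsilon> dt vn U V x)
             \<in> o[at_right 0](\<lambda>\<epsilon>. \<epsilon> powr - (1 + \<alpha>)))"

text \<open>
  The scheme has the formal limit \<open>L\<close>, a relation between the stages \<open>U\<close> and the new
  value \<open>un1\<close>. First, \<open>L\<close> holds for the leading terms of every family of solutions of the
  scheme for which \<open>U\<close>, together with its first two space derivatives, and \<open>un1\<close> have a
  leading term of order one. No convergence of \<open>V\<close> or \<open>vn1\<close> is presupposed.
  Secondly, \<open>L\<close> is exactly the relation that the leading-order scheme imposes on
  \<open>U\<close> and \<open>un1\<close>.
\<close>

definition has_formal_limit ::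
  "nat \<Rightarrow> real mat \<Rightarrow> real vec \<Rightarrow> real mat \<Rightarrow> real vec \<Rightarrow>
   (real \<Rightarrow> real) \<Rightarrow> (real \<Rightarrow> real) \<Rightarrow> real \<Rightarrow> real \<Rightarrow> (real \<Rightarrow> real) \<Rightarrow> (real \<Rightarrow> real) \<Rightarrow>
   (stages \<Rightarrow> (real \<Rightarrow> real) \<Rightarrow> bool) \<Rightarrow> bool" where
  "has_formal_limit s At bt A b f p \<alpha> dt un vn L \<longleftrightarrow>
     (\<forall>U V un1 vn1 U0 un10.
        (\<forall>\<^sub>F \<epsilon> in at_right 0.
           (\<forall>i<s. C_k 2 (U \<epsilon> i) \<and> C_k 1 (V \<epsilon> i)) \<and>
           relaxation_scheme s At bt A b f p \<alpha> \<epsilon> dt un vn (U \<epsilon>) (V \<epsilon>) (un1 \<epsilon>) (vn1 \<epsilon>)) \<and>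
        (\<forall>i<s. C_k 2 (U0 i)) \<and>
        (\<forall>i<s. \<forall>k\<le>2. \<forall>x.
           ((\<lambda>\<epsilon>. (deriv ^^ k) (U \<epsilon> i) x) \<longlongrightarrow> (deriv ^^ k) (U0 i) x) (at_right 0)) \<and>
        (\<forall>x. ((\<lambda>\<epsilon>. un1 \<epsilon> x) \<longlongrightarrow> un10 x) (at_right 0))
        \<longrightarrow> L U0 un10) \<and>
     (\<forall>U0 un10. (\<forall>i<s. C_k 2 (U0 i)) \<longrightarrow>
        (L U0 un10 \<longleftrightarrow>
         (\<exists>V0 vn10. (\<forall>i<s. C_k 1 (V0 i)) \<and>
            leading_order_scheme s At bt A b f p \<alpha> dt un vn U0 V0 un10 vn10)))"

text \<open>
  The IMEX method for \<open>u_t + f(u)_x = p(u)_xx\<close>, convection explicit and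
  diffusion implicit.
\<close>

definition imex_convection_diffusion ::
  "nat \<Rightarrow> real mat \<Rightarrow> real vec \<Rightarrow> real mat \<Rightarrow> real vec \<Rightarrow>
   (real \<Rightarrow> real) \<Rightarrow> (real \<Rightarrow> real) \<Rightarrow> real \<Rightarrow> (real \<Rightarrow> real) \<Rightarrow> stages \<Rightarrow> (real \<Rightarrow> real) \<Rightarrow> bool" where
  "imex_convection_diffusion s At bt A b f p dt un U un1 \<longleftrightarrow>
     (\<forall>x. (1 / dt) \<cdot>\<^sub>v (at_point s U x - un x \<cdot>\<^sub>v ones s)
            + At *\<^sub>v at_point s (D_x (app f U)) x
          = A *\<^sub>v at_point s (D_xx (app p U)) x \<and>
          (un1 x - un x) / dt + bt \<bullet> at_point s (D_x (app f U)) x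
          = b \<bullet> at_point s (D_xx (app p U)) x)"

text \<open>The explicit Runge-Kutta method for \<open>u_t + f(u)_x = 0\<close>.\<close>

definition rk_conservation_law ::
  "nat \<Rightarrow> real mat \<Rightarrow> real vec \<Rightarrow> (real \<Rightarrow> real) \<Rightarrow> real \<Rightarrow> (real \<Rightarrow> real) \<Rightarrow>
   stages \<Rightarrow> (real \<Rightarrow> real) \<Rightarrow> bool" where
  "rk_conservation_law s At bt f dt un U un1 \<longleftrightarrow>
     (\<forall>x. (1 / dt) \<cdot>\<^sub>v (at_point s U x - un x \<cdot>\<^sub>v ones s)
            + At *\<^sub>v at_point s (D_x (app f U)) x
          = 0\<^sub>v s \<and>
          (un1 x - un x) / dt + bt \<bullet> at_point s (D_x (app f U)) x = 0)"

end

theory Submission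
  imports Defs "Jordan_Normal_Form.Determinant"
begin

text \<open>
  Global stiff accuracy removes the completion step: \<open>b\<close> and \<open>bt\<close> are the last rows of
  \<open>A\<close> and \<open>At\<close>, so \<open>un1\<close> is the last stage of \<open>U\<close>, and the right-hand
  side of the update for \<open>v\<close> is that of the last stage of \<open>V\<close>. Only the stage equations
  remain. Multiplied by \<open>\<epsilon> powr (1 + \<alpha>)\<close>, the stage equation for \<open>V\<close> reads
  \<open>\<epsilon>\<^bsup>1+\<alpha>\<^esup> (V - vn e) = dt (At f(U) - A V - \<epsilon>\<^bsup>1-\<alpha>\<^esup> A p(U)\<^sub>x)\<close>.
  The factor \<open>\<epsilon>\<^bsup>1-\<alpha>\<^esup>\<close> tends to a number \<open>\<kappa>\<close>, which is \<open>1\<close> for \<open>\<alpha> = 1\<close> and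
  \<open>0\<close> for \<open>\<alpha> < 1\<close>. If the left-hand side vanishes in the limit, then
  \<open>A V = At f(U) - \<kappa> A p(U)\<^sub>x\<close>; its space derivative, inserted into
  \<open>U = un e - dt A V\<^sub>x\<close>, is the limit scheme
  \<open>U = un e - dt (At f(U)\<^sub>x - \<kappa> A p(U)\<^sub>x\<^sub>x)\<close>. The two parts of the theorem are the
  values \<open>\<kappa> = 1\<close> and \<open>\<kappa> = 0\<close> of \<open>has_formal_limit_limit_relation\<close>.

  Two points need an argument, and both are settled by forward substitution, because \<open>A\<close> is
  lower triangular with \<open>A $$ (i, i) \<noteq> 0\<close> for all \<open>i > 0\<close> in type I and in type II
  alike (\<open>A_diag\<close>).

  For families of solutions, nothing is known about \<open>V\<close> as \<open>\<epsilon>\<close> tends to zero. But the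
  equation for \<open>U\<close> says that \<open>A V\<^sub>x = (un e - U) / dt\<close>, which converges; hence so does
  \<open>V\<^sub>x\<close>, by \<open>convergent_lower_triangular_system\<close>. If \<open>A $$ (0, 0) = 0\<close>, the first
  component is not determined in this way, but then the first stage equation is
  \<open>V 0 = vn\<close>. It is therefore the differentiated \<open>V\<close>-equation whose limit is taken.

  Conversely, for a solution \<open>U\<close> of the limit scheme, a stage vector \<open>V\<close> with
  \<open>A (V + \<kappa> p(U)\<^sub>x) = At f(U)\<close> has to be found. The system is solvable even if
  \<open>A $$ (0, 0) = 0\<close>, since \<open>At\<close> is strictly lower triangular and the first component of
  its right-hand side is zero (\<open>solvable_lower_triangular_system\<close>).
\<close>

\<comment> \<open>Keeps \<open>C_k 1\<close> in this form, so that the rules about it apply after simplification.\<close>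
declare One_nat_def [simp del]

section \<open>Functions of class \<open>C\<^sup>1\<close> and \<open>C\<^sup>2\<close>\<close>

lemma C_k_1_iff:
  "C_k 1 g \<longleftrightarrow> (\<forall>x. g differentiable (at x)) \<and> continuous_on UNIV (deriv g)"
  by (simp add: C_k_def One_nat_def)

lemma C_k_2_iff: "C_k 2 g \<longleftrightarrow> (\<forall>x. g differentiable (at x)) \<and> C_k 1 (deriv g)"
  by (auto simp: C_k_def One_nat_def numeral_2_eq_2 less_Suc_eq)

lemma C_k_1I:
  assumes "\<And>x. (g has_real_derivative g' x) (at x)" and "continuous_on UNIV g'"
  shows "C_k 1 g"
proof -
  have "deriv g = g'"
    using assms(1) by (auto intro: DERIV_imp_deriv)
  with assms show ?thesis
    by (auto simp: C_k_1_iff real_differentiable_def)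
qed

lemma C_k_1_deriv: "C_k 1 g \<Longrightarrow> (g has_real_derivative deriv g x) (at x)"
  by (simp add: C_k_1_iff DERIV_deriv_iff_real_differentiable)

lemma C_k_1_continuous_deriv: "C_k 1 g \<Longrightarrow> continuous_on UNIV (deriv g)"
  by (simp add: C_k_1_iff)

lemma C_k_1_continuous: "C_k 1 g \<Longrightarrow> continuous_on UNIV g"
  by (intro continuous_at_imp_continuous_on ballI DERIV_isCont[OF C_k_1_deriv])

lemma C_k_2_deriv: "C_k 2 g \<Longrightarrow> C_k 1 (deriv g)"
  by (simp add: C_k_2_iff)

lemma C_k_2_imp_1: "C_k 2 g \<Longrightarrow> C_k 1 g"
  using C_k_1_continuous[of "deriv g"] by (simp add: C_k_1_iff C_k_2_iff)

lemma C_k_1_const: "C_k 1 (\<lambda>x. c)"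
  by (rule C_k_1I[where g' = "\<lambda>_. 0"]) auto

lemma C_k_1_add: "C_k 1 g \<Longrightarrow> C_k 1 h \<Longrightarrow> C_k 1 (\<lambda>x. g x + h x)"
  by (rule C_k_1I[where g' = "\<lambda>x. deriv g x + deriv h x"])
     (auto intro!: derivative_eq_intros continuous_intros
        C_k_1_deriv C_k_1_continuous_deriv)

lemma C_k_1_mult:
  assumes "C_k 1 g" "C_k 1 h"
  shows "C_k 1 (\<lambda>x. g x * h x)"
proof (rule C_k_1I)
  show "((\<lambda>x. g x * h x) has_real_derivative deriv g x * h x + deriv h x * g x) (at x)" for x
    by (rule DERIV_mult[OF assms[THEN C_k_1_deriv]])
  show "continuous_on UNIV (\<lambda>x. deriv g x * h x + deriv h x * g x)"
    using assms[THEN C_k_1_continuous] assms[THEN C_k_1_continuous_deriv]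
    by (intro continuous_intros)
qed

lemma C_k_1_sum:
  assumes "\<And>j. j \<in> J \<Longrightarrow> C_k 1 (g j)"
  shows "C_k 1 (\<lambda>x. \<Sum>j\<in>J. c j * g j x)"
  using assms
  by (induction J rule: infinite_finite_induct)
     (auto intro!: C_k_1_const C_k_1_add C_k_1_mult)

lemma DERIV_compose_C_k_1:
  assumes "C_k 1 g" "C_k 1 w"
  shows "((\<lambda>x. g (w x)) has_real_derivative deriv g (w x) * deriv w x) (at x)"
  using DERIV_chain2[OF C_k_1_deriv[OF assms(1)] C_k_1_deriv[OF assms(2)]] .

lemma deriv_compose:
  assumes "C_k 1 g" "C_k 1 w"
  shows "deriv (\<lambda>x. g (w x)) = (\<lambda>x. deriv g (w x) * deriv w x)"
  using DERIV_compose_C_k_1[OF assms] by (auto intro: DERIV_imp_deriv)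

lemma C_k_1_compose:
  assumes "C_k 1 g" "C_k 1 w"
  shows "C_k 1 (\<lambda>x. g (w x))"
proof (rule C_k_1I[OF DERIV_compose_C_k_1[OF assms]])
  have "continuous_on UNIV (\<lambda>x. deriv g (w x))"
    using assms continuous_on_compose2[OF C_k_1_continuous_deriv C_k_1_continuous, of g w] by simp
  then show "continuous_on UNIV (\<lambda>x. deriv g (w x) * deriv w x)"
    using C_k_1_continuous_deriv[OF assms(2)] by (intro continuous_intros)
qed

lemma C_k_1_deriv_compose:
  assumes "C_k 2 g" "C_k 2 w"
  shows "C_k 1 (deriv (\<lambda>x. g (w x)))"
  using assms
  by (simp add: deriv_compose C_k_2_imp_1 C_k_1_mult C_k_1_compose C_k_2_deriv)

lemma deriv_deriv_compose:
  assumes "C_k 2 g" "C_k 2 w"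
  shows "deriv (deriv (\<lambda>x. g (w x))) x =
    deriv (deriv g) (w x) * deriv w x * deriv w x + deriv (deriv w) x * deriv g (w x)"
proof -
  have "((\<lambda>x. deriv g (w x) * deriv w x) has_real_derivative
      deriv (deriv g) (w x) * deriv w x * deriv w x + deriv (deriv w) x * deriv g (w x)) (at x)"
    using assms
    by (intro DERIV_mult DERIV_compose_C_k_1 C_k_1_deriv) (auto simp: C_k_2_imp_1 C_k_2_deriv)
  then show ?thesis
    using assms by (simp add: deriv_compose C_k_2_imp_1 DERIV_imp_deriv)
qed

lemma tendsto_deriv_compose:
  assumes g: "C_k 1 g" and w0: "C_k 1 w0"
    and w: "\<forall>\<^sub>F \<epsilon> in F. C_k 1 (w \<epsilon>)"
    and lim: "((\<lambda>\<epsilon>. w \<epsilon> x) \<longlongrightarrow> w0 x) F" "((\<lambda>\<epsilon>. deriv (w \<epsilon>) x) \<longlongrightarrow> deriv w0 x) F"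
  shows "((\<lambda>\<epsilon>. deriv (\<lambda>x. g (w \<epsilon> x)) x) \<longlongrightarrow> deriv (\<lambda>x. g (w0 x)) x) F"
proof (rule Lim_transform_eventually)
  have "((\<lambda>\<epsilon>. deriv g (w \<epsilon> x)) \<longlongrightarrow> deriv g (w0 x)) F"
    by (rule continuous_on_tendsto_compose[OF C_k_1_continuous_deriv[OF g] lim(1)]) auto
  then show "((\<lambda>\<epsilon>. deriv g (w \<epsilon> x) * deriv (w \<epsilon>) x) \<longlongrightarrow> deriv (\<lambda>x. g (w0 x)) x) F"
    unfolding deriv_compose[OF g w0] by (intro tendsto_mult lim(2))
  show "\<forall>\<^sub>F \<epsilon> in F. deriv g (w \<epsilon> x) * deriv (w \<epsilon>) x = deriv (\<lambda>x. g (w \<epsilon> x)) x"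
    using w by eventually_elim (simp add: deriv_compose g)
qed

lemma tendsto_deriv_deriv_compose:
  assumes g: "C_k 2 g" and w0: "C_k 2 w0"
    and w: "\<forall>\<^sub>F \<epsilon> in F. C_k 2 (w \<epsilon>)"
    and lim: "((\<lambda>\<epsilon>. w \<epsilon> x) \<longlongrightarrow> w0 x) F" "((\<lambda>\<epsilon>. deriv (w \<epsilon>) x) \<longlongrightarrow> deriv w0 x) F"
      "((\<lambda>\<epsilon>. deriv (deriv (w \<epsilon>)) x) \<longlongrightarrow> deriv (deriv w0) x) F"
  shows "((\<lambda>\<epsilon>. deriv (deriv (\<lambda>x. g (w \<epsilon> x))) x) \<longlongrightarrow> deriv (deriv (\<lambda>x. g (w0 x))) x) F"
proof (rule Lim_transform_eventually)
  have "((\<lambda>\<epsilon>. deriv g (w \<epsilon> x)) \<longlongrightarrow> deriv g (w0 x)) F"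
    by (rule continuous_on_tendsto_compose[OF C_k_1_continuous_deriv[OF C_k_2_imp_1[OF g]] lim(1)])
      auto
  moreover have "((\<lambda>\<epsilon>. deriv (deriv g) (w \<epsilon> x)) \<longlongrightarrow> deriv (deriv g) (w0 x)) F"
    by (rule continuous_on_tendsto_compose[OF C_k_1_continuous_deriv[OF C_k_2_deriv[OF g]] lim(1)])
      auto
  ultimately show "((\<lambda>\<epsilon>. deriv (deriv g) (w \<epsilon> x) * deriv (w \<epsilon>) x * deriv (w \<epsilon>) x
      + deriv (deriv (w \<epsilon>)) x * deriv g (w \<epsilon> x)) \<longlongrightarrow> deriv (deriv (\<lambda>x. g (w0 x))) x) F"
    unfolding deriv_deriv_compose[OF g w0] by (intro tendsto_add tendsto_mult lim)
  show "\<forall>\<^sub>F \<epsilon> in F. deriv (deriv g) (w \<epsilon> x) * deriv (w \<epsilon>) x * deriv (w \<epsilon>) x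
      + deriv (deriv (w \<epsilon>)) x * deriv g (w \<epsilon> x) = deriv (deriv (\<lambda>x. g (w \<epsilon> x))) x"
    using w by eventually_elim (simp add: deriv_deriv_compose g)
qed

lemma tendsto_powr_at_right_0:
  assumes "0 < a"
  shows "((\<lambda>\<epsilon>::real. \<epsilon> powr a) \<longlongrightarrow> 0) (at_right 0)"
proof (rule tendsto_zero_powrI)
  show "\<forall>\<^sub>F \<epsilon>::real in at_right 0. 0 \<le> \<epsilon>"
    using eventually_at_right_less[of "0::real"] by eventually_elim simp
qed (use assms in \<open>auto intro: tendsto_intros\<close>)

section \<open>Lower triangular systems\<close>

definition row_apply :: "nat \<Rightarrow> real mat \<Rightarrow> nat \<Rightarrow> (nat \<Rightarrow> real) \<Rightarrow> real" where
  "row_apply s M i y = (\<Sum>j<s. M $$ (i, j) * y j)"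

lemma row_apply_add: "row_apply s M i (\<lambda>j. y j + z j) = row_apply s M i y + row_apply s M i z"
  by (simp add: row_apply_def sum.distrib distrib_left)

lemma row_apply_scale: "row_apply s M i (\<lambda>j. c * y j) = c * row_apply s M i y"
  by (simp add: row_apply_def sum_distrib_left mult_ac)

lemma vec_add_smult_vec: "vec s y + c \<cdot>\<^sub>v vec s z = vec s (\<lambda>j. y j + c * z j :: real)"
  by auto

lemma mult_mat_vec_nth:
  assumes "M \<in> carrier_mat s s" "i < s"
  shows "(M *\<^sub>v vec s y) $ i = row_apply s M i y"
  using assms by (auto simp: scalar_prod_def row_apply_def lessThan_atLeast0 intro!: sum.cong)

lemma DERIV_row_apply:
  assumes "\<And>j. j < s \<Longrightarrow> (W j has_real_derivative W' j) (at x)"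
  shows "((\<lambda>x. row_apply s M i (\<lambda>j. W j x)) has_real_derivative row_apply s M i W') (at x)"
  unfolding row_apply_def by (intro DERIV_sum DERIV_cmult assms) simp

lemma C_k_1_row_apply:
  assumes "\<And>j. j < s \<Longrightarrow> C_k 1 (W j)"
  shows "C_k 1 (\<lambda>x. row_apply s M i (\<lambda>j. W j x))"
  unfolding row_apply_def by (rule C_k_1_sum) (use assms in simp)

lemma tendsto_row_apply:
  assumes "\<And>j. j < s \<Longrightarrow> ((\<lambda>\<epsilon>. y \<epsilon> j) \<longlongrightarrow> y0 j) F"
  shows "((\<lambda>\<epsilon>. row_apply s M i (y \<epsilon>)) \<longlongrightarrow> row_apply s M i y0) F"
  unfolding row_apply_def by (intro tendsto_sum tendsto_mult tendsto_const assms) simp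

lemma row_apply_lower_triangular:
  assumes "\<And>j. j < s \<Longrightarrow> i < j \<Longrightarrow> M $$ (i, j) = 0" and "i < s"
  shows "row_apply s M i y = M $$ (i, i) * y i + (\<Sum>j<i. M $$ (i, j) * y j)"
proof -
  have "row_apply s M i y = (\<Sum>j\<in>{..i}. M $$ (i, j) * y j)"
    unfolding row_apply_def using assms by (intro sum.mono_neutral_right) auto
  then show ?thesis
    by (simp add: lessThan_Suc_atMost[symmetric])
qed

text \<open>The determinant of a triangular matrix is the product of its diagonal entries.\<close>

lemma invertible_lower_triangular_diag:
  fixes M :: "real mat"
  assumes M: "M \<in> carrier_mat n n" and "invertible_mat M"
    and low: "\<And>i j. i < j \<Longrightarrow> j < n \<Longrightarrow> M $$ (i, j) = 0" and "i < n"
  shows "M $$ (i, i) \<noteq> 0"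
proof -
  obtain B where B: "M * B = 1\<^sub>m n" "B * M = 1\<^sub>m (dim_row B)"
    using assms by (auto simp: invertible_mat_def inverts_mat_def)
  have "B \<in> carrier_mat n n"
    using B M by (metis carrier_matD carrier_matI index_mult_mat(2,3) index_one_mat(2,3))
  then have "det M * det B = 1"
    using det_mult[OF M] B(1) by (metis det_one)
  then have "det M \<noteq> 0"
    by auto
  then have "prod_list (diag_mat M) \<noteq> 0"
    using det_lower_triangular[OF low M] by simp
  then show ?thesis
    using M \<open>i < n\<close> by (force simp: prod_list_zero_iff diag_mat_def)
qed

text \<open>
  Forward substitution expresses each \<open>y \<epsilon> i\<close> by row \<open>i\<close> and the earlier components.
  A vanishing first pivot is the degenerate case of type II methods; there the first
  component needs a separate reason to converge.
\<close>

lemma convergent_lower_triangular_system: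
  assumes low: "\<And>i j. i < s \<Longrightarrow> j < s \<Longrightarrow> i < j \<Longrightarrow> M $$ (i, j) = 0"
    and diag: "\<And>i. 0 < i \<Longrightarrow> i < s \<Longrightarrow> M $$ (i, i) \<noteq> 0"
    and rows: "\<And>i. i < s \<Longrightarrow> \<exists>l. ((\<lambda>\<epsilon>. row_apply s M i (y \<epsilon>)) \<longlongrightarrow> l) F"
    and first: "M $$ (0, 0) = 0 \<Longrightarrow> \<exists>l. ((\<lambda>\<epsilon>. y \<epsilon> 0) \<longlongrightarrow> l) F"
  shows "i < s \<Longrightarrow> \<exists>l. ((\<lambda>\<epsilon>. y \<epsilon> i) \<longlongrightarrow> l) F"
proof (induction i rule: less_induct)
  case (less i)
  show ?case
  proof (cases "M $$ (i, i) = 0")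
    case True
    then show ?thesis
      using diag first less.prems by (cases "i = 0") auto
  next
    case False
    have "\<forall>j<i. \<exists>l. ((\<lambda>\<epsilon>. y \<epsilon> j) \<longlongrightarrow> l) F"
      using less by auto
    then obtain L where L: "\<And>j. j < i \<Longrightarrow> ((\<lambda>\<epsilon>. y \<epsilon> j) \<longlongrightarrow> L j) F"
      by metis
    obtain l where l: "((\<lambda>\<epsilon>. row_apply s M i (y \<epsilon>)) \<longlongrightarrow> l) F"
      using rows less.prems by blast
    have "y \<epsilon> i = (row_apply s M i (y \<epsilon>) - (\<Sum>j<i. M $$ (i, j) * y \<epsilon> j)) / M $$ (i, i)" for \<epsilon>
      using False row_apply_lower_triangular[of s i M "y \<epsilon>"] low less.prems by simp
    moreover have "((\<lambda>\<epsilon>. (row_apply s M i (y \<epsilon>) - (\<Sum>j<i. M $$ (i, j) * y \<epsilon> j)) / M $$ (i, i))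
        \<longlongrightarrow> (l - (\<Sum>j<i. M $$ (i, j) * L j)) / M $$ (i, i)) F"
      using False by (intro tendsto_intros l L) auto
    ultimately show ?thesis
      by auto
  qed
qed

text \<open>
  The unknowns and the right-hand sides are functions of \<open>x\<close>; each step of the forward
  substitution is a linear combination with constant coefficients and so preserves
  \<open>C\<^sup>1\<close>. The zero right-hand side in the first row makes the system consistent when
  the first pivot vanishes.
\<close>

lemma solvable_lower_triangular_system:
  assumes low: "\<And>i j. i < s \<Longrightarrow> j < s \<Longrightarrow> i < j \<Longrightarrow> M $$ (i, j) = 0"
    and diag: "\<And>i. 0 < i \<Longrightarrow> i < s \<Longrightarrow> M $$ (i, i) \<noteq> 0"
    and g: "\<And>i. i < s \<Longrightarrow> C_k 1 (g i)" and first: "\<And>x. g 0 x = 0"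
  obtains W where "\<And>i. i < s \<Longrightarrow> C_k 1 (W i)"
    and "\<And>i x. i < s \<Longrightarrow> row_apply s M i (\<lambda>j. W j x) = g i x"
proof -
  have "n \<le> s \<Longrightarrow> \<exists>W. \<forall>i<n. C_k 1 (W i) \<and>
    (\<forall>x. M $$ (i, i) * W i x + (\<Sum>j<i. M $$ (i, j) * W j x) = g i x)" for n
  proof (induction n)
    case 0
    then show ?case by simp
  next
    case (Suc n)
    then obtain W where W: "\<And>i. i < n \<Longrightarrow> C_k 1 (W i)"
      "\<And>i x. i < n \<Longrightarrow> M $$ (i, i) * W i x + (\<Sum>j<i. M $$ (i, j) * W j x) = g i x"
      by auto
    \<comment> \<open>If this pivot vanishes, then \<open>n = 0\<close> and division by zero gives \<open>w = 0\<close>;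
      any value would do, as both sides of the first equation are zero.\<close>
    define w where "w x = (1 / M $$ (n, n)) * (g n x + (\<Sum>j<n. (- M $$ (n, j)) * W j x))" for x
    have "C_k 1 w"
      unfolding w_def using Suc.prems
      by (intro C_k_1_mult C_k_1_const C_k_1_add C_k_1_sum W g) auto
    moreover have "M $$ (n, n) * w x + (\<Sum>j<n. M $$ (n, j) * W j x) = g n x" for x
    proof (cases "M $$ (n, n) = 0")
      case True
      then have "n = 0"
        using diag[of n] Suc.prems by auto
      then show ?thesis
        using True first by simp
    next
      case False
      then show ?thesis
        by (simp add: w_def sum_negf)
    qed
    ultimately show ?case
      using W by (intro exI[of _ "W(n := w)"]) (auto simp: less_Suc_eq)
  qed
  from this[of s] obtain W where W: "\<And>i. i < s \<Longrightarrow> C_k 1 (W i)"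
      "\<And>i x. i < s \<Longrightarrow> M $$ (i, i) * W i x + (\<Sum>j<i. M $$ (i, j) * W j x) = g i x"
    by auto
  moreover have "row_apply s M i (\<lambda>j. W j x) = g i x" if "i < s" for i x
    using W(2)[OF that] row_apply_lower_triangular[of s i M] low that by simp
  ultimately show thesis
    using that by blast
qed

section \<open>Globally stiffly accurate schemes in components\<close>

locale gsa_imex =
  fixes s :: nat and At A :: "real mat" and bt b :: "real vec"
  assumes tableaux: "imex_tableaux s At bt A b"
    and type: "type_I A \<or> type_II s A"
    and gsa: "globally_stiffly_accurate s At bt A b"
begin

lemma s_pos: "0 < s"
  and At_carrier: "At \<in> carrier_mat s s" and A_carrier: "A \<in> carrier_mat s s"
  and At_strict: "i < s \<Longrightarrow> j < s \<Longrightarrow> i \<le> j \<Longrightarrow> At $$ (i, j) = 0"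
  and A_lower: "i < s \<Longrightarrow> j < s \<Longrightarrow> i < j \<Longrightarrow> A $$ (i, j) = 0"
  using tableaux by (auto simp: imex_tableaux_def)

text \<open>
  The one consequence of type I or type II that the argument uses. In type II the block
  \<open>Ah\<close> is \<open>A\<close> without its first row and column, hence again lower triangular.
\<close>

lemma A_diag:
  assumes "0 < i" "i < s"
  shows "A $$ (i, i) \<noteq> 0"
proof (cases "type_I A")
  case True
  then show ?thesis
    using A_carrier A_lower assms
    by (intro invertible_lower_triangular_diag[of A s]) (auto simp: type_I_def)
next
  case False
  then obtain a Ah where Ah: "a \<in> carrier_mat (s - 1) 1" "Ah \<in> carrier_mat (s - 1) (s - 1)"
      "invertible_mat Ah" "A = four_block_mat (0\<^sub>m 1 1) (0\<^sub>m 1 (s - 1)) a Ah"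
    using type by (auto simp: type_II_def)
  have nth: "A $$ (Suc k, Suc l) = Ah $$ (k, l)" if "k < s - 1" "l < s - 1" for k l
    using that Ah by simp
  have "Ah $$ (i - 1, i - 1) \<noteq> 0"
  proof (rule invertible_lower_triangular_diag[OF Ah(2,3)])
    show "Ah $$ (k, l) = 0" if "k < l" "l < s - 1" for k l
      using nth[of k l] A_lower[of "Suc k" "Suc l"] that by auto
  qed (use assms in auto)
  then show ?thesis
    using nth[of "i - 1" "i - 1"] assms by simp
qed

lemma b_apply: "b \<bullet> vec s y = row_apply s A (s - 1) y"
  using gsa by (auto simp: scalar_prod_def row_apply_def globally_stiffly_accurate_def
      lessThan_atLeast0 intro!: sum.cong)

text \<open>
  Global stiff accuracy gives the last entry of \<open>bt\<close> separately, as zero; this is also the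
  last diagonal entry of the strictly lower triangular \<open>At\<close>.
\<close>

lemma bt_apply: "bt \<bullet> vec s y = row_apply s At (s - 1) y"
proof -
  have "bt $ j = At $$ (s - 1, j)" if "j < s" for j
    using gsa that s_pos At_strict[of "s - 1" j]
    by (cases "j = s - 1") (auto simp: globally_stiffly_accurate_def)
  then show ?thesis
    by (auto simp: scalar_prod_def row_apply_def lessThan_atLeast0 intro!: sum.cong)
qed

lemma row_apply_At_0: "row_apply s At 0 y = 0"
  unfolding row_apply_def using At_strict s_pos by (intro sum.neutral) auto

lemma row_apply_A_0: "A $$ (0, 0) = 0 \<Longrightarrow> row_apply s A 0 y = 0"
  using row_apply_lower_triangular[of s 0 A y] A_lower s_pos by simp

lemma u_equations_iff:
  "u_equations s A b dt un U V un1 \<longleftrightarrow>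
    (\<forall>x. (\<forall>i<s. U i x = un x - dt * row_apply s A i (\<lambda>j. deriv (V j) x)) \<and>
      un1 x = U (s - 1) x)"
  using s_pos A_carrier
  by (auto simp: u_equations_def at_point_def ones_def D_x_def vec_eq_iff b_apply
      mult_mat_vec_nth simp del: index_mult_mat_vec)

lemma v_stage_rhs_nth:
  assumes "i < s"
  shows "v_stage_rhs s At A f p \<alpha> \<epsilon> dt vn U V x $ i =
    vn x + dt / \<epsilon> powr (1 + \<alpha>) * (row_apply s At i (\<lambda>j. f (U j x))
      - row_apply s A i (\<lambda>j. V j x) - \<epsilon> powr (1 - \<alpha>) * row_apply s A i (\<lambda>j. deriv (\<lambda>x. p (U j x)) x))"
  using assms A_carrier At_carrier
  by (simp add: v_stage_rhs_def at_point_def ones_def app_def D_x_def vec_add_smult_vec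
      mult_mat_vec_nth row_apply_add row_apply_scale algebra_simps del: index_mult_mat_vec)

lemma v_step_rhs_eq_last_stage:
  "v_step_rhs s bt b f p \<alpha> \<epsilon> dt vn U V x = v_stage_rhs s At A f p \<alpha> \<epsilon> dt vn U V x $ (s - 1)"
  using s_pos
  by (simp add: v_stage_rhs_nth v_step_rhs_def at_point_def app_def D_x_def vec_add_smult_vec
      b_apply bt_apply row_apply_add row_apply_scale algebra_simps)

text \<open>
  Both limit schemes at once, with \<open>\<kappa>\<close> the limit of \<open>\<epsilon> powr (1 - \<alpha>)\<close>, solved for
  \<open>U\<close>. By global stiff accuracy the update of \<open>u\<close> is the last stage.
\<close>

definition limit_relation ::
  "real \<Rightarrow> (real \<Rightarrow> real) \<Rightarrow> (real \<Rightarrow> real) \<Rightarrow> real \<Rightarrow> (real \<Rightarrow> real) \<Rightarrow> stages \<Rightarrow> (real \<Rightarrow> real) \<Rightarrow> bool"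
  where
  "limit_relation \<kappa> f p dt un U un1 \<longleftrightarrow>
    (\<forall>x. (\<forall>i<s. U i x = un x - dt * (row_apply s At i (\<lambda>j. deriv (\<lambda>x. f (U j x)) x)
          - \<kappa> * row_apply s A i (\<lambda>j. deriv (deriv (\<lambda>x. p (U j x))) x))) \<and>
      un1 x = U (s - 1) x)"

lemma imex_convection_diffusion_eq_limit_relation:
  assumes "0 < dt"
  shows "imex_convection_diffusion s At bt A b f p dt un = limit_relation 1 f p dt un"
proof -
  have "1 / dt * (y - z) + c = d \<longleftrightarrow> y = z - dt * (c - 1 * d)"
    and "(y - z) / dt + c = d \<longleftrightarrow> y = z - dt * (c - 1 * d)" for y z c d
    using assms by (auto simp: field_simps)
  then show ?thesis
    using s_pos A_carrier At_carrier
    by (auto 0 3 simp: fun_eq_iff imex_convection_diffusion_def limit_relation_def at_point_def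
        ones_def app_def D_x_def D_xx_def vec_eq_iff b_apply bt_apply mult_mat_vec_nth
        simp del: index_mult_mat_vec)
qed

lemma rk_conservation_law_eq_limit_relation:
  assumes "0 < dt"
  shows "rk_conservation_law s At bt f dt un = limit_relation 0 f p dt un"
proof -
  have "1 / dt * (y - z) + c = 0 \<longleftrightarrow> y = z - dt * (c - 0 * d)"
    and "(y - z) / dt + c = 0 \<longleftrightarrow> y = z - dt * (c - 0 * d)" for y z c d
    using assms by (auto simp: field_simps)
  then show ?thesis
    using s_pos At_carrier
    by (auto 0 3 simp: fun_eq_iff rk_conservation_law_def limit_relation_def at_point_def
        ones_def app_def D_x_def vec_eq_iff bt_apply mult_mat_vec_nth
        simp del: index_mult_mat_vec)
qed

section \<open>The limit of the scheme\<close>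

text \<open>
  Divided by \<open>\<epsilon> powr - (1 + \<alpha>)\<close>, the residual has a limit: \<open>c\<close> and
  \<open>vn\<close> drop out, and the diffusion term keeps the weight \<open>\<kappa>\<close>. The residual is of
  smaller order exactly if this limit is zero.
\<close>

lemma stage_leading_order_iff:
  assumes "0 \<le> \<alpha>" "0 < dt" "i < s"
    and \<kappa>: "((\<lambda>\<epsilon>. \<epsilon> powr (1 - \<alpha>)) \<longlongrightarrow> \<kappa>) (at_right 0)"
  shows "(\<lambda>\<epsilon>. c - v_stage_rhs s At A f p \<alpha> \<epsilon> dt vn U V x $ i)
      \<in> o[at_right 0](\<lambda>\<epsilon>. \<epsilon> powr - (1 + \<alpha>)) \<longleftrightarrow>
    row_apply s At i (\<lambda>j. f (U j x))
      = row_apply s A i (\<lambda>j. V j x) + \<kappa> * row_apply s A i (\<lambda>j. deriv (\<lambda>x. p (U j x)) x)"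
    (is "?r \<in> o[_](?g) \<longleftrightarrow> ?F = ?V + \<kappa> * ?P")
proof -
  have pos: "\<forall>\<^sub>F \<epsilon>::real in at_right 0. 0 < \<epsilon>"
    by (rule eventually_at_right_less)
  have "((\<lambda>\<epsilon>::real. \<epsilon> powr (1 + \<alpha>)) \<longlongrightarrow> 0) (at_right 0)"
    using \<open>0 \<le> \<alpha>\<close> by (intro tendsto_powr_at_right_0) simp
  then have "((\<lambda>\<epsilon>. \<epsilon> powr (1 + \<alpha>) * (c - vn x) - dt * (?F - ?V - \<epsilon> powr (1 - \<alpha>) * ?P))
      \<longlongrightarrow> 0 * (c - vn x) - dt * (?F - ?V - \<kappa> * ?P)) (at_right 0)"
    by (intro tendsto_intros \<kappa>)
  then have "((\<lambda>\<epsilon>. \<epsilon> powr (1 + \<alpha>) * (c - vn x) - dt * (?F - ?V - \<epsilon> powr (1 - \<alpha>) * ?P))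
      \<longlongrightarrow> - dt * (?F - ?V - \<kappa> * ?P)) (at_right 0)"
    by simp
  then have lim: "((\<lambda>\<epsilon>. ?r \<epsilon> / ?g \<epsilon>) \<longlongrightarrow> - dt * (?F - ?V - \<kappa> * ?P)) (at_right 0)"
  proof (rule Lim_transform_eventually)
    show "\<forall>\<^sub>F \<epsilon> in at_right 0. \<epsilon> powr (1 + \<alpha>) * (c - vn x)
        - dt * (?F - ?V - \<epsilon> powr (1 - \<alpha>) * ?P) = ?r \<epsilon> / ?g \<epsilon>"
      using pos
    proof eventually_elim
      case (elim \<epsilon>)
      then show ?case
        unfolding v_stage_rhs_nth[OF \<open>i < s\<close>] powr_minus by (simp add: field_simps)
    qed
  qed
  have "?r \<in> o[at_right 0](?g) \<longleftrightarrow> ((\<lambda>\<epsilon>. ?r \<epsilon> / ?g \<epsilon>) \<longlongrightarrow> 0) (at_right 0)"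
    using pos by (auto intro!: smalloI_tendsto dest: smalloD_tendsto elim: eventually_mono)
  also have "\<dots> \<longleftrightarrow> - dt * (?F - ?V - \<kappa> * ?P) = 0"
  proof
    show "- dt * (?F - ?V - \<kappa> * ?P) = 0" if "((\<lambda>\<epsilon>. ?r \<epsilon> / ?g \<epsilon>) \<longlongrightarrow> 0) (at_right 0)"
      by (rule tendsto_unique[OF trivial_limit_at_right_real lim that])
  qed (use lim in metis)
  also have "\<dots> \<longleftrightarrow> ?F = ?V + \<kappa> * ?P"
    using \<open>0 < dt\<close> by auto
  finally show ?thesis .
qed

lemma leading_order_scheme_iff:
  assumes "0 \<le> \<alpha>" "0 < dt"
    and "((\<lambda>\<epsilon>. \<epsilon> powr (1 - \<alpha>)) \<longlongrightarrow> \<kappa>) (at_right 0)"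
  shows "leading_order_scheme s At bt A b f p \<alpha> dt un vn U V un1 vn1 \<longleftrightarrow>
    u_equations s A b dt un U V un1 \<and>
    (\<forall>x. \<forall>i<s. row_apply s At i (\<lambda>j. f (U j x))
      = row_apply s A i (\<lambda>j. V j x) + \<kappa> * row_apply s A i (\<lambda>j. deriv (\<lambda>x. p (U j x)) x))"
  using s_pos
  by (auto simp: leading_order_scheme_def v_step_rhs_eq_last_stage
      stage_leading_order_iff[OF assms(1,2) _ assms(3)] simp del: minus_add_distrib)

text \<open>
  Differentiating the leading-order \<open>V\<close>-equation and eliminating \<open>A V\<^sub>x\<close> gives one
  direction. For the other, \<open>V = W - \<kappa> p(U)\<^sub>x\<close> where \<open>W\<close> solves
  \<open>A W = At f(U)\<close>.
\<close>

lemma limit_relation_iff_leading_order: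
  assumes "0 \<le> \<alpha>" "0 < dt"
    and \<kappa>: "((\<lambda>\<epsilon>. \<epsilon> powr (1 - \<alpha>)) \<longlongrightarrow> \<kappa>) (at_right 0)"
    and f: "C_k 1 f" and p: "C_k 2 p" and U: "\<forall>i<s. C_k 2 (U i)"
  shows "limit_relation \<kappa> f p dt un U un1 \<longleftrightarrow>
    (\<exists>V vn1. (\<forall>i<s. C_k 1 (V i)) \<and> leading_order_scheme s At bt A b f p \<alpha> dt un vn U V un1 vn1)"
proof -
  define P where "P j = deriv (\<lambda>x. p (U j x))" for j
  have fU: "C_k 1 (\<lambda>x. f (U j x))" and P: "C_k 1 (P j)" if "j < s" for j
    using U f p that by (auto simp: P_def C_k_1_compose C_k_2_imp_1 C_k_1_deriv_compose)
  have differentiated: "row_apply s A i (\<lambda>j. deriv (V j) x)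
      = row_apply s At i (\<lambda>j. deriv (\<lambda>x. f (U j x)) x) - \<kappa> * row_apply s A i (\<lambda>j. deriv (P j) x)"
    if V: "\<forall>i<s. C_k 1 (V i)" and "i < s"
      and eq: "\<forall>x. row_apply s At i (\<lambda>j. f (U j x))
        = row_apply s A i (\<lambda>j. V j x) + \<kappa> * row_apply s A i (\<lambda>j. P j x)"
    for V i x
  proof -
    have "((\<lambda>x. row_apply s At i (\<lambda>j. f (U j x)) - \<kappa> * row_apply s A i (\<lambda>j. P j x))
        has_real_derivative row_apply s At i (\<lambda>j. deriv (\<lambda>x. f (U j x)) x)
          - \<kappa> * row_apply s A i (\<lambda>j. deriv (P j) x)) (at x)"
      by (intro DERIV_diff DERIV_cmult DERIV_row_apply C_k_1_deriv fU P)
    moreover have "(\<lambda>x. row_apply s At i (\<lambda>j. f (U j x)) - \<kappa> * row_apply s A i (\<lambda>j. P j x))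
        = (\<lambda>x. row_apply s A i (\<lambda>j. V j x))"
      using eq by auto
    moreover have "((\<lambda>x. row_apply s A i (\<lambda>j. V j x)) has_real_derivative
        row_apply s A i (\<lambda>j. deriv (V j) x)) (at x)"
      using V by (intro DERIV_row_apply C_k_1_deriv) auto
    ultimately show ?thesis
      by (auto intro: DERIV_unique)
  qed
  show ?thesis
  proof
    assume L: "limit_relation \<kappa> f p dt un U un1"
    obtain W where W: "\<And>i. i < s \<Longrightarrow> C_k 1 (W i)"
      "\<And>i x. i < s \<Longrightarrow> row_apply s A i (\<lambda>j. W j x) = row_apply s At i (\<lambda>j. f (U j x))"
      using solvable_lower_triangular_system[of s A "\<lambda>i x. row_apply s At i (\<lambda>j. f (U j x))",
          OF A_lower A_diag C_k_1_row_apply[OF fU] row_apply_At_0] by blast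
    define V where "V j x = W j x + (- \<kappa>) * P j x" for j x
    have V: "\<forall>i<s. C_k 1 (V i)"
      unfolding V_def by (intro allI impI C_k_1_add C_k_1_mult C_k_1_const W P)
    have eq: "\<forall>x. \<forall>i<s. row_apply s At i (\<lambda>j. f (U j x))
        = row_apply s A i (\<lambda>j. V j x) + \<kappa> * row_apply s A i (\<lambda>j. P j x)"
      unfolding V_def row_apply_add row_apply_scale by (simp add: W(2))
    have "u_equations s A b dt un U V un1"
      using L differentiated[OF V] eq by (simp add: u_equations_iff limit_relation_def P_def)
    \<comment> \<open>The value of \<open>vn1\<close> is of lower order, so any witness for it serves.\<close>
    then show "\<exists>V vn1. (\<forall>i<s. C_k 1 (V i)) \<and>
        leading_order_scheme s At bt A b f p \<alpha> dt un vn U V un1 vn1"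
      using V eq by (auto simp: leading_order_scheme_iff[OF assms(1-3)] P_def)
  next
    assume "\<exists>V vn1. (\<forall>i<s. C_k 1 (V i)) \<and>
        leading_order_scheme s At bt A b f p \<alpha> dt un vn U V un1 vn1"
    then obtain V where V: "\<forall>i<s. C_k 1 (V i)" and "u_equations s A b dt un U V un1"
      "\<forall>x. \<forall>i<s. row_apply s At i (\<lambda>j. f (U j x))
        = row_apply s A i (\<lambda>j. V j x) + \<kappa> * row_apply s A i (\<lambda>j. P j x)"
      by (auto simp: leading_order_scheme_iff[OF assms(1-3)] P_def)
    then show "limit_relation \<kappa> f p dt un U un1"
      using differentiated[OF V] by (simp add: u_equations_iff limit_relation_def P_def)
  qed
qed

text \<open>
  The limit is taken in the space derivative of the \<open>V\<close>-equation, not in the equation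
  itself: the scheme controls \<open>V\<^sub>x\<close> through \<open>U\<close>, and this makes the term
  \<open>\<epsilon> powr (1 + \<alpha>) * (V\<^sub>x - vn\<^sub>x)\<close> negligible.
\<close>

lemma limit_relation_of_solutions:
  assumes "0 \<le> \<alpha>" "0 < dt"
    and \<kappa>: "((\<lambda>\<epsilon>. \<epsilon> powr (1 - \<alpha>)) \<longlongrightarrow> \<kappa>) (at_right 0)"
    and f: "C_k 1 f" and p: "C_k 2 p" and vn: "C_k 1 vn"
    and sol: "\<forall>\<^sub>F \<epsilon> in at_right 0. (\<forall>i<s. C_k 2 (U \<epsilon> i) \<and> C_k 1 (V \<epsilon> i)) \<and>
      relaxation_scheme s At bt A b f p \<alpha> \<epsilon> dt un vn (U \<epsilon>) (V \<epsilon>) (un1 \<epsilon>) (vn1 \<epsilon>)"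
    and U0: "\<forall>i<s. C_k 2 (U0 i)"
    and lim: "\<forall>i<s. \<forall>k\<le>2. \<forall>x.
      ((\<lambda>\<epsilon>. (deriv ^^ k) (U \<epsilon> i) x) \<longlongrightarrow> (deriv ^^ k) (U0 i) x) (at_right 0)"
    and lim1: "\<forall>x. ((\<lambda>\<epsilon>. un1 \<epsilon> x) \<longlongrightarrow> un10 x) (at_right 0)"
  shows "limit_relation \<kappa> f p dt un U0 un10"
proof -
  define P where "P \<epsilon> j = deriv (\<lambda>x. p (U \<epsilon> j x))" for \<epsilon> j
  define Fx where "Fx w i x = row_apply s At i (\<lambda>j. deriv (\<lambda>x. f (w j x)) x)" for w i x
  define Pxx where "Pxx w i x = row_apply s A i (\<lambda>j. deriv (deriv (\<lambda>x. p (w j x))) x)" for w i x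
  have pos: "\<forall>\<^sub>F \<epsilon>::real in at_right 0. 0 < \<epsilon>"
    by (rule eventually_at_right_less)
  have limU: "((\<lambda>\<epsilon>. U \<epsilon> i x) \<longlongrightarrow> U0 i x) (at_right 0)"
    "((\<lambda>\<epsilon>. deriv (U \<epsilon> i) x) \<longlongrightarrow> deriv (U0 i) x) (at_right 0)"
    "((\<lambda>\<epsilon>. deriv (deriv (U \<epsilon> i)) x) \<longlongrightarrow> deriv (deriv (U0 i)) x) (at_right 0)"
    if "i < s" for i x
    using lim that by (force dest: spec[where x = 0] spec[where x = 1] spec[where x = 2]
        simp: numeral_2_eq_2)+
  have U2: "\<forall>\<^sub>F \<epsilon> in at_right 0. C_k 2 (U \<epsilon> i)" if "i < s" for i
    using sol by eventually_elim (use that in auto)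
  have limF: "((\<lambda>\<epsilon>. Fx (U \<epsilon>) i x) \<longlongrightarrow> Fx U0 i x) (at_right 0)" for i x
    unfolding Fx_def
  proof (rule tendsto_row_apply)
    fix j assume j: "j < s"
    have "\<forall>\<^sub>F \<epsilon> in at_right 0. C_k 1 (U \<epsilon> j)"
      using U2[OF j] by eventually_elim (rule C_k_2_imp_1)
    then show "((\<lambda>\<epsilon>. deriv (\<lambda>x. f (U \<epsilon> j x)) x) \<longlongrightarrow> deriv (\<lambda>x. f (U0 j x)) x) (at_right 0)"
      using U0 j by (intro tendsto_deriv_compose[OF f _ _ limU(1,2)]) (simp_all add: C_k_2_imp_1)
  qed
  have limP: "((\<lambda>\<epsilon>. Pxx (U \<epsilon>) i x) \<longlongrightarrow> Pxx U0 i x) (at_right 0)" for i x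
    unfolding Pxx_def
    using U0 U2
    by (intro tendsto_row_apply tendsto_deriv_deriv_compose[OF p _ _ limU]) simp_all
  have ueq: "\<forall>\<^sub>F \<epsilon> in at_right 0. \<forall>x. (\<forall>i<s. U \<epsilon> i x
      = un x - dt * row_apply s A i (\<lambda>j. deriv (V \<epsilon> j) x)) \<and> un1 \<epsilon> x = U \<epsilon> (s - 1) x"
    using sol by eventually_elim (simp add: relaxation_scheme_def u_equations_iff)
  have veq: "\<forall>\<^sub>F \<epsilon> in at_right 0. \<forall>x. \<forall>i<s. V \<epsilon> i x
      = vn x + dt / \<epsilon> powr (1 + \<alpha>) * (row_apply s At i (\<lambda>j. f (U \<epsilon> j x))
        - row_apply s A i (\<lambda>j. V \<epsilon> j x) - \<epsilon> powr (1 - \<alpha>) * row_apply s A i (\<lambda>j. P \<epsilon> j x))"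
    using sol
  proof eventually_elim
    case (elim \<epsilon>)
    then have "at_point s (V \<epsilon>) x = v_stage_rhs s At A f p \<alpha> \<epsilon> dt vn (U \<epsilon>) (V \<epsilon>) x" for x
      by (simp add: relaxation_scheme_def)
    then have "V \<epsilon> i x = v_stage_rhs s At A f p \<alpha> \<epsilon> dt vn (U \<epsilon>) (V \<epsilon>) x $ i"
      if "i < s" for i x
      using that by (metis at_point_def index_vec)
    then show ?case
      by (simp add: v_stage_rhs_nth P_def)
  qed
  have rows: "((\<lambda>\<epsilon>. row_apply s A i (\<lambda>j. deriv (V \<epsilon> j) x)) \<longlongrightarrow> (un x - U0 i x) / dt)
      (at_right 0)" if "i < s" for i x
  proof (rule Lim_transform_eventually)
    show "((\<lambda>\<epsilon>. (un x - U \<epsilon> i x) / dt) \<longlongrightarrow> (un x - U0 i x) / dt) (at_right 0)"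
      using \<open>0 < dt\<close> that by (intro tendsto_intros limU) auto
    show "\<forall>\<^sub>F \<epsilon> in at_right 0. (un x - U \<epsilon> i x) / dt
        = row_apply s A i (\<lambda>j. deriv (V \<epsilon> j) x)"
      using ueq by eventually_elim (use that \<open>0 < dt\<close> in \<open>simp add: field_simps\<close>)
  qed
  have limVx: "\<exists>l. ((\<lambda>\<epsilon>. deriv (V \<epsilon> i) x) \<longlongrightarrow> l) (at_right 0)" if "i < s" for i x
  proof (rule convergent_lower_triangular_system[OF A_lower A_diag _ _ that])
    assume "A $$ (0, 0) = 0"
    then have A_0: "row_apply s A 0 y = 0" for y
      by (rule row_apply_A_0)
    have "\<forall>\<^sub>F \<epsilon> in at_right 0. V \<epsilon> 0 = vn"
      using veq
    proof eventually_elim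
      case (elim \<epsilon>)
      show ?case
      proof
        fix x
        show "V \<epsilon> 0 x = vn x"
          using elim[rule_format, of 0 x] s_pos by (simp add: A_0 row_apply_At_0)
      qed
    qed
    then have "\<forall>\<^sub>F \<epsilon> in at_right 0. deriv vn x = deriv (V \<epsilon> 0) x"
      by eventually_elim simp
    then show "\<exists>l. ((\<lambda>\<epsilon>. deriv (V \<epsilon> 0) x) \<longlongrightarrow> l) (at_right 0)"
      by (blast intro: Lim_transform_eventually tendsto_const)
  qed (use rows in auto)
  have stage: "Fx U0 i x - (un x - U0 i x) / dt - \<kappa> * Pxx U0 i x = 0" if i: "i < s" for i x
  proof -
    have "\<forall>\<^sub>F \<epsilon> in at_right 0. \<epsilon> powr (1 + \<alpha>) * (deriv (V \<epsilon> i) x - deriv vn x)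
        = dt * (Fx (U \<epsilon>) i x - row_apply s A i (\<lambda>j. deriv (V \<epsilon> j) x)
          - \<epsilon> powr (1 - \<alpha>) * Pxx (U \<epsilon>) i x)"
      using sol veq pos
    proof eventually_elim
      case (elim \<epsilon>)
      have V: "C_k 1 (V \<epsilon> j)" and fU: "C_k 1 (\<lambda>x. f (U \<epsilon> j x))" and PU: "C_k 1 (P \<epsilon> j)"
        if "j < s" for j
        using elim(1) f p that
        by (auto simp: P_def C_k_1_compose C_k_2_imp_1 C_k_1_deriv_compose)
      have "((\<lambda>x. vn x + dt / \<epsilon> powr (1 + \<alpha>) * (row_apply s At i (\<lambda>j. f (U \<epsilon> j x))
          - row_apply s A i (\<lambda>j. V \<epsilon> j x) - \<epsilon> powr (1 - \<alpha>) * row_apply s A i (\<lambda>j. P \<epsilon> j x)))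
        has_real_derivative deriv vn x + dt / \<epsilon> powr (1 + \<alpha>) *
          (row_apply s At i (\<lambda>j. deriv (\<lambda>x. f (U \<epsilon> j x)) x)
          - row_apply s A i (\<lambda>j. deriv (V \<epsilon> j) x)
          - \<epsilon> powr (1 - \<alpha>) * row_apply s A i (\<lambda>j. deriv (P \<epsilon> j) x))) (at x)"
        by (intro DERIV_add DERIV_diff DERIV_cmult DERIV_row_apply C_k_1_deriv vn V fU PU)
      moreover have "(\<lambda>x. vn x + dt / \<epsilon> powr (1 + \<alpha>) * (row_apply s At i (\<lambda>j. f (U \<epsilon> j x))
          - row_apply s A i (\<lambda>j. V \<epsilon> j x) - \<epsilon> powr (1 - \<alpha>) * row_apply s A i (\<lambda>j. P \<epsilon> j x)))
          = V \<epsilon> i"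
        by (rule ext) (use elim(2) i in metis)
      ultimately have "deriv (V \<epsilon> i) x = deriv vn x + dt / \<epsilon> powr (1 + \<alpha>) *
          (Fx (U \<epsilon>) i x - row_apply s A i (\<lambda>j. deriv (V \<epsilon> j) x) - \<epsilon> powr (1 - \<alpha>) * Pxx (U \<epsilon>) i x)"
        by (simp add: DERIV_imp_deriv Fx_def Pxx_def P_def)
      then show ?case
        using elim(3) by simp
    qed
    moreover have "((\<lambda>\<epsilon>. \<epsilon> powr (1 + \<alpha>) * (deriv (V \<epsilon> i) x - deriv vn x)) \<longlongrightarrow> 0) (at_right 0)"
    proof -
      obtain l where l: "((\<lambda>\<epsilon>. deriv (V \<epsilon> i) x) \<longlongrightarrow> l) (at_right 0)"
        using limVx i by blast
      have "((\<lambda>\<epsilon>::real. \<epsilon> powr (1 + \<alpha>)) \<longlongrightarrow> 0) (at_right 0)"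
        using \<open>0 \<le> \<alpha>\<close> by (intro tendsto_powr_at_right_0) simp
      then have "((\<lambda>\<epsilon>. \<epsilon> powr (1 + \<alpha>) * (deriv (V \<epsilon> i) x - deriv vn x))
          \<longlongrightarrow> 0 * (l - deriv vn x)) (at_right 0)"
        by (intro tendsto_intros l)
      then show ?thesis
        by simp
    qed
    ultimately have "((\<lambda>\<epsilon>. dt * (Fx (U \<epsilon>) i x - row_apply s A i (\<lambda>j. deriv (V \<epsilon> j) x)
          - \<epsilon> powr (1 - \<alpha>) * Pxx (U \<epsilon>) i x)) \<longlongrightarrow> 0) (at_right 0)"
      by (rule Lim_transform_eventually[rotated])
    moreover have "((\<lambda>\<epsilon>. dt * (Fx (U \<epsilon>) i x - row_apply s A i (\<lambda>j. deriv (V \<epsilon> j) x)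
          - \<epsilon> powr (1 - \<alpha>) * Pxx (U \<epsilon>) i x))
        \<longlongrightarrow> dt * (Fx U0 i x - (un x - U0 i x) / dt - \<kappa> * Pxx U0 i x)) (at_right 0)"
      by (intro tendsto_intros limF limP \<kappa> rows i)
    ultimately have "0 = dt * (Fx U0 i x - (un x - U0 i x) / dt - \<kappa> * Pxx U0 i x)"
      by (rule tendsto_unique[OF trivial_limit_at_right_real])
    then show ?thesis
      using \<open>0 < dt\<close> by auto
  qed
  have last: "un10 x = U0 (s - 1) x" for x
  proof (rule tendsto_unique[OF trivial_limit_at_right_real])
    show "((\<lambda>\<epsilon>. un1 \<epsilon> x) \<longlongrightarrow> un10 x) (at_right 0)"
      using lim1 by blast
    show "((\<lambda>\<epsilon>. un1 \<epsilon> x) \<longlongrightarrow> U0 (s - 1) x) (at_right 0)"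
      by (rule Lim_transform_eventually[OF limU(1)])
         (use s_pos ueq in \<open>auto elim: eventually_mono\<close>)
  qed
  have "U0 i x = un x - dt * (Fx U0 i x - \<kappa> * Pxx U0 i x)" if "i < s" for i x
    using stage[OF that, of x] \<open>0 < dt\<close> by (simp add: field_simps)
  then show ?thesis
    using last by (simp add: limit_relation_def Fx_def Pxx_def)
qed

theorem has_formal_limit_limit_relation:
  assumes "0 \<le> \<alpha>" "0 < dt"
    and "((\<lambda>\<epsilon>. \<epsilon> powr (1 - \<alpha>)) \<longlongrightarrow> \<kappa>) (at_right 0)"
    and "C_k 1 f" "C_k 2 p" "C_k 1 vn"
  shows "has_formal_limit s At bt A b f p \<alpha> dt un vn (limit_relation \<kappa> f p dt un)"
  unfolding has_formal_limit_def
proof (intro conjI allI impI)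
  fix U V un1 vn1 U0 un10
  assume "(\<forall>\<^sub>F \<epsilon> in at_right 0. (\<forall>i<s. C_k 2 (U \<epsilon> i) \<and> C_k 1 (V \<epsilon> i)) \<and>
      relaxation_scheme s At bt A b f p \<alpha> \<epsilon> dt un vn (U \<epsilon>) (V \<epsilon>) (un1 \<epsilon>) (vn1 \<epsilon>)) \<and>
    (\<forall>i<s. C_k 2 (U0 i)) \<and>
    (\<forall>i<s. \<forall>k\<le>2. \<forall>x.
      ((\<lambda>\<epsilon>. (deriv ^^ k) (U \<epsilon> i) x) \<longlongrightarrow> (deriv ^^ k) (U0 i) x) (at_right 0)) \<and>
    (\<forall>x. ((\<lambda>\<epsilon>. un1 \<epsilon> x) \<longlongrightarrow> un10 x) (at_right 0))"
  then show "limit_relation \<kappa> f p dt un U0 un10"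
    using limit_relation_of_solutions[OF assms] by blast
next
  fix U0 un10
  assume "\<forall>i<s. C_k 2 (U0 i)"
  then show "limit_relation \<kappa> f p dt un U0 un10 \<longleftrightarrow>
      (\<exists>V0 vn10. (\<forall>i<s. C_k 1 (V0 i)) \<and>
        leading_order_scheme s At bt A b f p \<alpha> dt un vn U0 V0 un10 vn10)"
    using limit_relation_iff_leading_order assms by blast
qed

end

theorem theorem2:
  fixes s :: nat
    and At A :: "real mat" and bt b :: "real vec"
    and f p un vn :: "real \<Rightarrow> real"
    and \<alpha> dt :: real
  assumes "0 \<le> \<alpha>" and "\<alpha> \<le> 1"
    and "0 < dt"
    and "C_k 1 f" and "C_k 2 p" and "\<forall>u. 0 < deriv p u"
    and "C_k 2 un" and "C_k 1 vn"
    and "imex_tableaux s At bt A b"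
    and "type_I A \<or> type_II s A"
    and "globally_stiffly_accurate s At bt A b"
  shows "(\<alpha> = 1 \<longrightarrow>
            has_formal_limit s At bt A b f p \<alpha> dt un vn
              (imex_convection_diffusion s At bt A b f p dt un)) \<and>
         (\<alpha> < 1 \<longrightarrow>
            has_formal_limit s At bt A b f p \<alpha> dt un vn
              (rk_conservation_law s At bt f dt un))"
proof -
  interpret gsa_imex s At A bt b
    using assms(9-11) by unfold_locales
  note limit = has_formal_limit_limit_relation[OF assms(1,3) _ assms(4,5,8)]
  show ?thesis
  proof (intro conjI impI)
    assume "\<alpha> = 1"
    have "((\<lambda>\<epsilon>::real. \<epsilon> powr (1 - \<alpha>)) \<longlongrightarrow> 1) (at_right 0)"
    proof (rule Lim_transform_eventually[OF tendsto_const])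
      show "\<forall>\<^sub>F \<epsilon>::real in at_right 0. 1 = \<epsilon> powr (1 - \<alpha>)"
        using eventually_at_right_less[of "0::real"]
        by eventually_elim (simp add: \<open>\<alpha> = 1\<close>)
    qed
    then show "has_formal_limit s At bt A b f p \<alpha> dt un vn
        (imex_convection_diffusion s At bt A b f p dt un)"
      unfolding imex_convection_diffusion_eq_limit_relation[OF assms(3)] by (rule limit)
  next
    assume "\<alpha> < 1"
    then have "((\<lambda>\<epsilon>::real. \<epsilon> powr (1 - \<alpha>)) \<longlongrightarrow> 0) (at_right 0)"
      by (intro tendsto_powr_at_right_0) simp
    then show "has_formal_limit s At bt A b f p \<alpha> dt un vn
        (rk_conservation_law s At bt f dt un)"
      unfolding rk_conservation_law_eq_limit_relation[OF assms(3), of f un p] by (rule limit)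
  qed
qed

end
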